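(* Let $L$ be an involutive link and let $(i,j)\in\mathbb{Z}^2$. If $\dim_{\mathbb{F}}\operatorname{Kh}^{i,j}(L)\le 1$, then the induced differential $d_\tau^*$ vanishes in grading $(i,j)$, i.e. $d_\tau^*\colon\operatorname{Kh}^{i,j}(L)\to\operatorname{Kh}^{i,j}(L)$ is zero.
   Context: Let $R\colon S^2\to S^2$ be reflection in a great circle $\mathbf a\subset S^2$, and let $\tau\colon S^3\to S^3$ be the orientation-preserving involution obtained from $(p,q)\mapsto(R(p),-q)$ on $S^2\times(-\infty,\infty)$ by adding two points $\pm\infty$; its fixed point set is the axis $\mathbf a$. An involutive link is an (oriented) link $L\subset S^3$ with $\tau(L)=L$ as a set and $\mathbf a\not\subset L$. An involutive diagram $D$ of $L$ is the projection to $S^2$, with over/under information, of a generic representative missing $\pm\infty$; it is symmetric under $R$. $\mathbb{F}=\mathbb{Z}/2\mathbb{Z}$, and $\operatorname{Kh}^{i,j}(L)$ is Khovanov cohomology over $\mathbb{F}$, the cohomology of the Khovanov complex $(\operatorname{CKh}^{*,j}(D),d)$ with $d\colon\operatorname{CKh}^{i,j}(D)\to\operatorname{CKh}^{i+1,j}(D)$, which has basis the decorations by $v_\pm$ of the components of smoothings of $D$. Reflection in $\mathbf a$ gives an involution on smoothings of $D$ and bijections between the components of a smoothing and of its image; this induces an involution $\tau$ on each $\operatorname{CKh}^{i,j}(D)$, commuting with $d$. Put $d_\tau=\mathrm{id}+\tau$. The total differential $\partial=d+d_\tau$ is filtered with respect to $\mathcal F^i=\bigoplus_{l\le i}\operatorname{CKh}^{l,j}(D)$;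 the associated spectral sequence has $E^2_{\mathcal F}=\operatorname{Kh}(L)$, and its differential on this page is the map $d_\tau^*\colon\operatorname{Kh}^{i,j}(L)\to\operatorname{Kh}^{i,j}(L)$ induced on cohomology by $d_\tau$. *)

theory Defs
  imports
    "HOL-Analysis.Analysis"
    "HOL-Library.Z2"
    "HOL-Library.Function_Algebras"
    "Jordan_Normal_Form.Missing_VectorSpace"
begin

section \<open>The involution of the three-sphere\<close>

text \<open>
  The three-sphere is the unit sphere of \<open>\<real>\<^sup>3 \<times> \<real>\<close>.  The points \<open>(0, 1)\<close> and \<open>(0, -1)\<close> are
  \<open>+\<infinity>\<close> and \<open>-\<infinity>\<close>; their complement is identified with \<open>S\<^sup>2 \<times> (-\<infinity>, \<infinity>)\<close> by \<open>cylinder\<close>,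
  with inverse \<open>x \<mapsto> (shadow x, height x)\<close>.  A great circle of \<open>S\<^sup>2\<close> is given by a unit normal \<open>a\<close>.
\<close>

type_synonym space = "(real^3) \<times> real"

definition S3 :: "space set" where
  "S3 = sphere 0 1"

definition cylinder :: "real^3 \<Rightarrow> real \<Rightarrow> space" where
  "cylinder p q = (1 / sqrt (1 + q\<^sup>2)) *\<^sub>R (p, q)"

definition shadow :: "space \<Rightarrow> real^3" where
  "shadow x = sgn (fst x)"

definition height :: "space \<Rightarrow> real" where
  "height x = snd x / norm (fst x)"

definition great_circle :: "real^3 \<Rightarrow> (real^3) set" where
  "great_circle a = {p \<in> sphere 0 1. p \<bullet> a = 0}"

definition reflection :: "real^3 \<Rightarrow> real^3 \<Rightarrow> real^3" where
  "reflection a p = p - (2 * (p \<bullet> a)) *\<^sub>R a"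

definition tau :: "real^3 \<Rightarrow> space \<Rightarrow> space" where
  "tau a x = (reflection a (fst x), - snd x)"

definition axis :: "real^3 \<Rightarrow> space set" where
  "axis a = great_circle a \<times> {0}"

lemma shadow_cylinder: "norm p = 1 \<Longrightarrow> shadow (cylinder p q) = p"
proof -
  assume "norm p = 1"
  moreover have "sqrt (1 + q\<^sup>2) > 0" by (simp add: add_pos_nonneg)
  ultimately show ?thesis by (simp add: shadow_def cylinder_def sgn_div_norm)
qed

lemma height_cylinder: "norm p = 1 \<Longrightarrow> height (cylinder p q) = q"
proof -
  assume "norm p = 1"
  moreover have "sqrt (1 + q\<^sup>2) > 0" by (simp add: add_pos_nonneg)
  ultimately show ?thesis by (simp add: height_def cylinder_def)
qed

lemma tau_cylinder: "tau a (cylinder p q) = cylinder (reflection a p) (- q)"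
  by (simp add: tau_def cylinder_def reflection_def scaleR_diff_right mult.commute)

section \<open>Involutive links and their generic representatives\<close>

text \<open>An oriented link is given by oriented parametrisations, of period 1, of its components.\<close>

type_synonym link = "(real \<Rightarrow> space) list"

definition smooth :: "(real \<Rightarrow> 'a::real_normed_vector) \<Rightarrow> bool" where
  "smooth \<gamma> \<longleftrightarrow> (\<exists>D. D 0 = \<gamma> \<and> (\<forall>k t. (D k has_vector_derivative D (Suc k) t) (at t)))"

definition is_link :: "link \<Rightarrow> bool" where
  "is_link L \<longleftrightarrow>
     (\<forall>\<gamma>\<in>set L. smooth \<gamma> \<and> range \<gamma> \<subseteq> S3 \<and>
        (\<forall>t. \<gamma> (t + 1) = \<gamma> t \<and> vector_derivative \<gamma> (at t) \<noteq> 0)) \<and>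
     (\<forall>k<length L. \<forall>l<length L. \<forall>s t. (L ! k) s = (L ! l) t \<longrightarrow> k = l \<and> s - t \<in> \<int>)"

definition link_set :: "link \<Rightarrow> space set" where
  "link_set L = (\<Union>\<gamma>\<in>set L. range \<gamma>)"

definition involutive_link :: "real^3 \<Rightarrow> link \<Rightarrow> bool" where
  "involutive_link a L \<longleftrightarrow>
     is_link L \<and> tau a ` link_set L = link_set L \<and> \<not> axis a \<subseteq> link_set L"

text \<open>Ambient isotopy through homeomorphisms commuting with the involution, taking \<open>L\<close> to \<open>L'\<close>
  as oriented links.\<close>

definition equivariantly_isotopic :: "real^3 \<Rightarrow> link \<Rightarrow> link \<Rightarrow> bool" where
  "equivariantly_isotopic a L L' \<longleftrightarrow>
     (\<exists>H :: real \<Rightarrow> space \<Rightarrow> space.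
        continuous_on ({0..1} \<times> S3) (\<lambda>(t, x). H t x) \<and>
        (\<forall>t\<in>{0..1}. \<exists>G. homeomorphism S3 S3 (H t) G) \<and>
        (\<forall>x\<in>S3. H 0 x = x) \<and>
        (\<forall>t\<in>{0..1}. \<forall>x\<in>S3. H t (tau a x) = tau a (H t x)) \<and>
        H 1 ` link_set L = link_set L' \<and>
        (\<forall>\<gamma>\<in>set L. \<exists>\<delta>\<in>set L'. \<exists>\<phi> :: real \<Rightarrow> real.
           continuous_on UNIV \<phi> \<and> strict_mono \<phi> \<and> (\<forall>t. H 1 (\<gamma> t) = \<delta> (\<phi> t))))"

definition fibre :: "link \<Rightarrow> real^3 \<Rightarrow> space set" where
  "fibre L p = {x \<in> link_set L. shadow x = p}"

definition crossings :: "link \<Rightarrow> (real^3) set" where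
  "crossings L = {p. card (fibre L p) = 2}"

definition velocity :: "(real \<Rightarrow> space) \<Rightarrow> real \<Rightarrow> real^3" where
  "velocity \<gamma> t = vector_derivative (shadow \<circ> \<gamma>) (at t)"

text \<open>The link misses \<open>\<plusminus>\<infinity>\<close> and its projection to \<open>S\<^sup>2\<close> is an immersion whose only multiple points
  are finitely many transverse double points.\<close>

definition generic :: "link \<Rightarrow> bool" where
  "generic L \<longleftrightarrow>
     (0, 1) \<notin> link_set L \<and> (0, -1) \<notin> link_set L \<and>
     (\<forall>\<gamma>\<in>set L. \<forall>t. velocity \<gamma> t \<noteq> 0) \<and>
     (\<forall>p. finite (fibre L p) \<and> card (fibre L p) \<le> 2) \<and>
     finite (crossings L) \<and>
     (\<forall>\<gamma>\<in>set L. \<forall>\<delta>\<in>set L. \<forall>s t. \<gamma> s \<noteq> \<delta> t \<and> shadow (\<gamma> s) = shadow (\<delta> t) \<longrightarrow>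
        cross3 (velocity \<gamma> s) (velocity \<delta> t) \<noteq> 0)"

definition generic_representative :: "real^3 \<Rightarrow> link \<Rightarrow> link \<Rightarrow> bool" where
  "generic_representative a L L' \<longleftrightarrow>
     equivariantly_isotopic a L L' \<and> is_link L' \<and> generic L'"

section \<open>The diagram and its smoothings\<close>

text \<open>Everything from here on is for a link \<open>L\<close> that is already generic.  The sphere \<open>S\<^sup>2\<close> is seen from
  the outside, i.e. from \<open>+\<infinity>\<close>.\<close>

definition over :: "link \<Rightarrow> real^3 \<Rightarrow> space" where
  "over L p = (ARG_MAX height x. x \<in> fibre L p)"

definition under :: "link \<Rightarrow> real^3 \<Rightarrow> space" where
  "under L p = (ARG_MIN height x. x \<in> fibre L p)"

definition arcs :: "link \<Rightarrow> (real^3) set set" where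
  "arcs L = components (shadow ` link_set L - crossings L)"

text \<open>
  The directions at \<open>p\<close> of the half-edges of an arc \<open>e\<close> ending at the crossing \<open>p\<close>, and the two opposite
  directions of the projection of the strand through \<open>x\<close>.  Thus a half-edge at \<open>p\<close> is recorded by its
  (unit) direction, which also distinguishes the two ends of an arc both of whose ends are at \<open>p\<close>.
\<close>

definition arc_directions :: "(real^3) set \<Rightarrow> real^3 \<Rightarrow> (real^3) set" where
  "arc_directions e p = {w. \<exists>y :: nat \<Rightarrow> real^3.
     (\<forall>n. y n \<in> e) \<and> y \<longlonglongrightarrow> p \<and> (\<lambda>n. sgn (y n - p)) \<longlonglongrightarrow> w}"

definition strand_directions :: "link \<Rightarrow> space \<Rightarrow> (real^3) set" where
  "strand_directions L x = {w. \<exists>y :: nat \<Rightarrow> space.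
     (\<forall>n. y n \<in> link_set L - {x}) \<and> y \<longlonglongrightarrow> x \<and> (\<lambda>n. sgn (shadow (y n) - shadow x)) \<longlonglongrightarrow> w}"

text \<open>
  A smoothing is given by the set \<open>s\<close> of crossings at which the 1-smoothing is taken.  The 0-smoothing
  merges the two regions swept by the over-strand when it is turned counterclockwise onto the
  under-strand: it joins the over half-edge \<open>u\<close> to the under half-edge \<open>v\<close> following it clockwise, i.e.
  with \<open>det (p, u, v) < 0\<close>.  The 1-smoothing joins \<open>u\<close> to the under half-edge following it
  counterclockwise.
\<close>

definition joined :: "link \<Rightarrow> (real^3) set \<Rightarrow> ((real^3) set \<times> (real^3) set) set" where
  "joined L s = {(e, f). e \<in> arcs L \<and> f \<in> arcs L \<and> (\<exists>p\<in>crossings L.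
     \<exists>u \<in> arc_directions e p \<inter> strand_directions L (over L p).
     \<exists>v \<in> arc_directions f p \<inter> strand_directions L (under L p).
       if p \<in> s then p \<bullet> cross3 u v > 0 else p \<bullet> cross3 u v < 0)}"

text \<open>A component of a smoothing is recorded as the set of the arcs of the diagram it runs through.\<close>

type_synonym circle = "(real^3) set set"

definition circles :: "link \<Rightarrow> (real^3) set \<Rightarrow> circle set" where
  "circles L s = arcs L // ((joined L s \<union> (joined L s)\<inverse>)\<^sup>* \<inter> arcs L \<times> arcs L)"

definition crossing_sign_is :: "link \<Rightarrow> real \<Rightarrow> real^3 \<Rightarrow> bool" where
  "crossing_sign_is L \<epsilon> p \<longleftrightarrow> (\<exists>\<gamma>\<in>set L. \<exists>\<delta>\<in>set L. \<exists>s t. \<gamma> s = over L p \<and> \<delta> t = under L p \<and>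
     sgn (p \<bullet> cross3 (velocity \<gamma> s) (velocity \<delta> t)) = \<epsilon>)"

definition n_plus :: "link \<Rightarrow> nat" where
  "n_plus L = card {p \<in> crossings L. crossing_sign_is L 1 p}"

definition n_minus :: "link \<Rightarrow> nat" where
  "n_minus L = card {p \<in> crossings L. crossing_sign_is L (-1) p}"

section \<open>The Khovanov complex over the field with two elements\<close>

text \<open>
  A decorated smoothing is a pair \<open>(s, P)\<close>, where \<open>P\<close> is the set of the components of the smoothing \<open>s\<close>
  decorated by \<open>v\<^sub>+\<close>; the others are decorated by \<open>v\<^sub>-\<close>.
\<close>

type_synonym generator = "(real^3) set \<times> circle set"

type_synonym chain = "generator \<Rightarrow> bit"

definition generators :: "link \<Rightarrow> generator set" where
  "generators L = {(s, P). s \<subseteq> crossings L \<and> P \<subseteq> circles L s}"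

definition hom_degree :: "link \<Rightarrow> generator \<Rightarrow> int" where
  "hom_degree L = (\<lambda>(s, P). int (card s) - int (n_minus L))"

definition quantum_degree :: "link \<Rightarrow> generator \<Rightarrow> int" where
  "quantum_degree L = (\<lambda>(s, P). int (card P) - int (card (circles L s - P))
     + int (card s) + int (n_plus L) - 2 * int (n_minus L))"

text \<open>
  \<open>merges A P B Q\<close>: the two circles in \<open>A\<close>, with \<open>v\<^sub>+\<close> on those in \<open>P\<close>, are merged into the one in \<open>B\<close>, and
  the decoration \<open>Q\<close> occurs in the image of \<open>P\<close> under
  \<open>v\<^sub>+ \<otimes> v\<^sub>+ \<mapsto> v\<^sub>+\<close>, \<open>v\<^sub>+ \<otimes> v\<^sub>-, v\<^sub>- \<otimes> v\<^sub>+ \<mapsto> v\<^sub>-\<close>, \<open>v\<^sub>- \<otimes> v\<^sub>- \<mapsto> 0\<close>.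
  Similarly \<open>splits\<close> is for \<open>v\<^sub>+ \<mapsto> v\<^sub>+ \<otimes> v\<^sub>- + v\<^sub>- \<otimes> v\<^sub>+\<close>, \<open>v\<^sub>- \<mapsto> v\<^sub>- \<otimes> v\<^sub>-\<close>.
\<close>

definition merges :: "circle set \<Rightarrow> circle set \<Rightarrow> circle set \<Rightarrow> circle set \<Rightarrow> bool" where
  "merges A P B Q \<longleftrightarrow> (\<exists>a a' b. a \<noteq> a' \<and> A = {a, a'} \<and> B = {b} \<and>
     (if b \<in> Q then a \<in> P \<and> a' \<in> P else (a \<in> P) \<noteq> (a' \<in> P)))"

definition splits :: "circle set \<Rightarrow> circle set \<Rightarrow> circle set \<Rightarrow> circle set \<Rightarrow> bool" where
  "splits A P B Q \<longleftrightarrow> (\<exists>a b b'. b \<noteq> b' \<and> A = {a} \<and> B = {b, b'} \<and>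
     (if a \<in> P then (b \<in> Q) \<noteq> (b' \<in> Q) else b \<notin> Q \<and> b' \<notin> Q))"

text \<open>The pairs of generators with matrix coefficient 1 in the differential: one crossing passes from
  the 0- to the 1-smoothing and the decorations of the circles common to both smoothings agree.\<close>

definition incident :: "link \<Rightarrow> generator \<Rightarrow> generator \<Rightarrow> bool" where
  "incident L = (\<lambda>(s, P) (s', P').
     (\<exists>p \<in> crossings L - s. s' = insert p s) \<and>
     P \<inter> circles L s' = P' \<inter> circles L s \<and>
     (merges (circles L s - circles L s') P (circles L s' - circles L s) P' \<or>
      splits (circles L s - circles L s') P (circles L s' - circles L s) P'))"

definition CKh :: "link \<Rightarrow> int \<Rightarrow> int \<Rightarrow> chain set" where
  "CKh L i j = {x. \<forall>g. x g \<noteq> 0 \<longrightarrow>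
     g \<in> generators L \<and> hom_degree L g = i \<and> quantum_degree L g = j}"

definition diff :: "link \<Rightarrow> chain \<Rightarrow> chain" where
  "diff L x = (\<lambda>h. if h \<in> generators L then \<Sum>g\<in>{g \<in> generators L. incident L g h}. x g else 0)"

section \<open>Khovanov cohomology\<close>

definition cocycles :: "link \<Rightarrow> int \<Rightarrow> int \<Rightarrow> chain set" where
  "cocycles L i j = {z \<in> CKh L i j. diff L z = 0}"

definition coboundaries :: "link \<Rightarrow> int \<Rightarrow> int \<Rightarrow> chain set" where
  "coboundaries L i j = diff L ` CKh L (i - 1) j"

definition cohomology_class :: "link \<Rightarrow> int \<Rightarrow> int \<Rightarrow> chain \<Rightarrow> chain set" where
  "cohomology_class L i j z = {z' \<in> cocycles L i j. z' - z \<in> coboundaries L i j}"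

definition F2 :: "bit ring" where
  "F2 = \<lparr>carrier = UNIV, mult = (*), one = 1, zero = 0, add = (+)\<rparr>"

text \<open>A vector space does not use the record fields \<open>mult\<close> and \<open>one\<close>.\<close>

definition Kh :: "link \<Rightarrow> int \<Rightarrow> int \<Rightarrow> (bit, chain set) module" where
  "Kh L i j = \<lparr>carrier = cohomology_class L i j ` cocycles L i j,
     mult = undefined, one = undefined,
     zero = cohomology_class L i j 0,
     add = (\<lambda>A B. the_elem ((\<lambda>(x, y). cohomology_class L i j (x + y)) ` (A \<times> B))),
     smult = (\<lambda>c A. the_elem ((\<lambda>x. cohomology_class L i j (\<lambda>g. c * x g)) ` A))\<rparr>"

section \<open>The involution on the Khovanov complex\<close>

definition reflect_circle :: "real^3 \<Rightarrow> circle \<Rightarrow> circle" where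
  "reflect_circle a C = (\<lambda>e. reflection a ` e) ` C"

definition reflect_generator :: "real^3 \<Rightarrow> generator \<Rightarrow> generator" where
  "reflect_generator a = (\<lambda>(s, P). (reflection a ` s, reflect_circle a ` P))"

text \<open>The linear extension of \<open>reflect_generator a\<close>, which is its own inverse.\<close>

definition tau_chain :: "real^3 \<Rightarrow> chain \<Rightarrow> chain" where
  "tau_chain a x = (\<lambda>g. x (reflect_generator a g))"

definition d_tau :: "real^3 \<Rightarrow> chain \<Rightarrow> chain" where
  "d_tau a x = x + tau_chain a x"

definition d_tau_star :: "real^3 \<Rightarrow> link \<Rightarrow> int \<Rightarrow> int \<Rightarrow> chain set \<Rightarrow> chain set" where
  "d_tau_star a L i j C = the_elem ((\<lambda>z. cohomology_class L i j (d_tau a z)) ` C)"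

end

theory Submission
  imports Defs "HOL-Library.Periodic_Fun"
begin

text \<open>
  A linear involution of a vector space over the field with two elements permutes its nonzero
  vectors.  If the dimension is at most one, there is at most one of these, so the involution is the
  identity, and adding the identity to it gives \<open>1 + 1 = 0\<close>.  The theorem is this remark applied to
  the map induced by \<open>tau_chain\<close> on a graded piece of Khovanov cohomology, so what has to be
  established is that this map exists and that the hypothesis on the dimension means what it says.

  For the existence, \<open>tau_chain\<close> has to preserve both gradings and commute with the differential
  (\<open>tau_chain_CKh\<close>, \<open>tau_chain_diff\<close>).  This comes down to the diagram being symmetric.  The
  involution of the three-sphere covers the reflection of the two-sphere and negates heights.  At a
  crossing it therefore exchanges the over- and the under-strand, and it also reverses the orientation
  of the projection sphere; either of the two alone would turn 0-smoothings into 1-smoothings, and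
  together they preserve the type of a smoothing (\<open>joined_R\<close>).  Hence the reflection carries the circles
  of a smoothing bijectively to those of the reflected smoothing (\<open>circles_R\<close>).  The gradings and the
  matrix of the differential are computed from the crossings and these circles, with shifts that are
  the same for all generators.

  The dimension is the least size of a finite spanning set, and it carries information only when the
  space is finite-dimensional.  This follows from the finiteness of the set of arcs of the diagram
  (\<open>finite_arcs\<close>): finitely many closed curves, cut at finitely many parameters, fall into finitely
  many pieces.
\<close>

section \<open>Khovanov cohomology as a vector space\<close>

lemma chain_diff_eq_add: "x - y = x + y" for x y :: chain
  by (rule ext) (simp only: plus_fun_def fun_diff_def minus_bit_def)

lemma chain_add_self: "x + x = 0" for x :: chain
proof
  show "(x + x) g = 0 g" for g by (cases "x g") simp_all
qed

lemma chain_add_self_left: "x + (x + y) = y" for x y :: chain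
  by (simp only: add.assoc[symmetric] chain_add_self add_0)

lemma field_F2: "field F2"
proof -
  have inverse: "\<exists>y. x + y = 0" for x :: bit
    by (rule exI[of _ x]) (cases x; simp)
  have mult_eq_1: "x * y = 1 \<longleftrightarrow> x = 1 \<and> y = 1" for x y :: bit
    by (cases x; cases y) simp_all
  have "cring F2"
    by (intro cringI abelian_groupI comm_monoidI)
      (simp_all add: F2_def inverse distrib_left ac_simps del: add_bit_eq_xor mult_bit_eq_and)
  moreover have "Units F2 = carrier F2 - {\<zero>\<^bsub>F2\<^esub>}"
    unfolding Units_def by (simp add: F2_def mult_eq_1 set_eq_iff del: mult_bit_eq_and)
  ultimately show ?thesis
    by (rule cring.cring_fieldI)
qed

lemma diff_add: "diff L (x + y) = diff L x + diff L y"
  unfolding diff_def plus_fun_def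
  by (rule ext) (simp only: sum.distrib if_distrib add_0 split: if_split, simp)

lemma diff_zero: "diff L 0 = 0"
  by (rule ext) (simp add: diff_def)

lemma CKh_add: "x \<in> CKh L i j \<Longrightarrow> y \<in> CKh L i j \<Longrightarrow> x + y \<in> CKh L i j"
  unfolding CKh_def mem_Collect_eq plus_fun_apply by (metis add_0)

lemma CKh_zero: "0 \<in> CKh L i j"
  by (simp add: CKh_def)

lemma cocycles_add: "x \<in> cocycles L i j \<Longrightarrow> y \<in> cocycles L i j \<Longrightarrow> x + y \<in> cocycles L i j"
  by (simp add: cocycles_def CKh_add diff_add)

lemma cocycles_zero: "0 \<in> cocycles L i j"
  by (simp add: cocycles_def CKh_zero diff_zero)

lemma coboundaries_add:
  assumes "x \<in> coboundaries L i j" "y \<in> coboundaries L i j"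
  shows "x + y \<in> coboundaries L i j"
proof -
  obtain u v where "u \<in> CKh L (i - 1) j" "x = diff L u" "v \<in> CKh L (i - 1) j" "y = diff L v"
    using assms unfolding coboundaries_def by blast
  then show ?thesis
    unfolding coboundaries_def by (intro image_eqI[of _ _ "u + v"]) (simp_all only: diff_add CKh_add)
qed

lemma coboundaries_zero: "0 \<in> coboundaries L i j"
  unfolding coboundaries_def by (rule image_eqI[of _ _ 0]) (simp_all only: diff_zero CKh_zero)

lemma cohomology_class_self: "z \<in> cocycles L i j \<Longrightarrow> z \<in> cohomology_class L i j z"
  by (simp add: cohomology_class_def coboundaries_zero)

lemma cohomology_class_eq_iff:
  assumes "z \<in> cocycles L i j" "w \<in> cocycles L i j"
  shows "cohomology_class L i j z = cohomology_class L i j w \<longleftrightarrow> z + w \<in> coboundaries L i j"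
proof
  assume "cohomology_class L i j z = cohomology_class L i j w"
  then have "z \<in> cohomology_class L i j w"
    using cohomology_class_self[OF assms(1)] by simp
  then show "z + w \<in> coboundaries L i j"
    by (simp add: cohomology_class_def chain_diff_eq_add)
next
  assume zw: "z + w \<in> coboundaries L i j"
  have "y + z \<in> coboundaries L i j \<longleftrightarrow> y + w \<in> coboundaries L i j" for y
  proof -
    have "y + w = (y + z) + (z + w)" "y + z = (y + w) + (z + w)"
      by (simp_all add: ac_simps chain_add_self chain_add_self_left)
    then show ?thesis
      using coboundaries_add[OF _ zw] by metis
  qed
  then show "cohomology_class L i j z = cohomology_class L i j w"
    by (simp add: cohomology_class_def chain_diff_eq_add)
qed

text \<open>The operations on cohomology are given as \<open>the_elem\<close> of an image of a class; this evaluates them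
  at a representative once the value is known not to depend on it.\<close>

lemma the_elem_image_const:
  assumes "x \<in> A" "\<And>y. y \<in> A \<Longrightarrow> f y = f x"
  shows "the_elem (f ` A) = f x"
proof -
  have "f ` A = {f x}" using assms by blast
  then show ?thesis by simp
qed

lemma carrier_Kh: "carrier (Kh L i j) = cohomology_class L i j ` cocycles L i j"
  and zero_Kh: "\<zero>\<^bsub>Kh L i j\<^esub> = cohomology_class L i j 0"
  by (simp_all add: Kh_def)

lemma in_cohomology_classD:
  assumes "z \<in> cocycles L i j" "y \<in> cohomology_class L i j z"
  shows "y \<in> cocycles L i j" "y + z \<in> coboundaries L i j"
  using assms by (auto simp: cohomology_class_def chain_diff_eq_add)

lemma add_Kh:
  assumes z: "z \<in> cocycles L i j" and w: "w \<in> cocycles L i j"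
  shows "cohomology_class L i j z \<oplus>\<^bsub>Kh L i j\<^esub> cohomology_class L i j w = cohomology_class L i j (z + w)"
proof -
  have *: "cohomology_class L i j (x + y) = cohomology_class L i j (z + w)"
    if "x \<in> cohomology_class L i j z" "y \<in> cohomology_class L i j w" for x y
  proof -
    have "(x + y) + (z + w) = (x + z) + (y + w)"
      by (simp only: ac_simps)
    then have "(x + y) + (z + w) \<in> coboundaries L i j"
      using in_cohomology_classD(2)[OF z that(1)] in_cohomology_classD(2)[OF w that(2)]
      by (simp only: coboundaries_add)
    then show ?thesis
      using in_cohomology_classD(1)[OF z that(1)] in_cohomology_classD(1)[OF w that(2)] z w
      by (simp add: cohomology_class_eq_iff cocycles_add)
  qed
  have "the_elem ((\<lambda>(x, y). cohomology_class L i j (x + y)) `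
      (cohomology_class L i j z \<times> cohomology_class L i j w)) =
      (\<lambda>(x, y). cohomology_class L i j (x + y)) (z, w)"
  proof (rule the_elem_image_const)
    show "(z, w) \<in> cohomology_class L i j z \<times> cohomology_class L i j w"
      by (simp add: cohomology_class_self z w)
    show "(\<lambda>(x, y). cohomology_class L i j (x + y)) q = (\<lambda>(x, y). cohomology_class L i j (x + y)) (z, w)"
      if "q \<in> cohomology_class L i j z \<times> cohomology_class L i j w" for q
      using that *[of "fst q" "snd q"] by (simp add: split_beta mem_Times_iff)
  qed
  then show ?thesis by (simp add: Kh_def)
qed

lemma smult_Kh:
  assumes z: "z \<in> cocycles L i j"
  shows "c \<odot>\<^bsub>Kh L i j\<^esub> cohomology_class L i j z =
    (if c = 0 then \<zero>\<^bsub>Kh L i j\<^esub> else cohomology_class L i j z)"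
proof -
  have *: "the_elem (f ` cohomology_class L i j z) = f z"
    if "\<And>y. y \<in> cohomology_class L i j z \<Longrightarrow> f y = f z" for f :: "chain \<Rightarrow> chain set"
    by (rule the_elem_image_const[where f = f and x = z], rule cohomology_class_self[OF z], erule that)
  have eq: "cohomology_class L i j y = cohomology_class L i j z"
    if "y \<in> cohomology_class L i j z" for y
    using in_cohomology_classD[OF z that] z by (simp add: cohomology_class_eq_iff)
  show ?thesis
  proof (cases "c = 0")
    case True
    then show ?thesis by (simp add: Kh_def zero_fun_def * del: mult_bit_eq_and)
  next
    case False
    then have "c = 1" by simp
    then show ?thesis using *[of "cohomology_class L i j", OF eq] by (simp add: Kh_def del: mult_bit_eq_and)
  qed
qed

lemma vectorspace_Kh: "vectorspace F2 (Kh L i j)"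
proof -
  interpret F: field F2 by (rule field_F2)
  have "abelian_group (Kh L i j)"
  proof (rule abelian_groupI)
    fix x assume "x \<in> carrier (Kh L i j)"
    then show "\<exists>y\<in>carrier (Kh L i j). y \<oplus>\<^bsub>Kh L i j\<^esub> x = \<zero>\<^bsub>Kh L i j\<^esub>"
      by (intro bexI[of _ x]) (auto simp: carrier_Kh zero_Kh add_Kh chain_add_self)
  qed (auto simp: carrier_Kh zero_Kh add_Kh cocycles_add cocycles_zero ac_simps)
  then interpret A: abelian_group "Kh L i j" .
  have "module F2 (Kh L i j)"
  proof (rule moduleI)
    show "cring F2" by (rule F.is_cring)
    fix b c x assume "b \<in> carrier F2" "c \<in> carrier F2" "x \<in> carrier (Kh L i j)"
    then obtain z where z: "z \<in> cocycles L i j" "x = cohomology_class L i j z"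
      by (auto simp: carrier_Kh)
    show "(b \<oplus>\<^bsub>F2\<^esub> c) \<odot>\<^bsub>Kh L i j\<^esub> x = b \<odot>\<^bsub>Kh L i j\<^esub> x \<oplus>\<^bsub>Kh L i j\<^esub> c \<odot>\<^bsub>Kh L i j\<^esub> x"
      by (cases b; cases c)
        (auto simp: z smult_Kh F2_def zero_Kh add_Kh cocycles_zero chain_add_self)
    show "(b \<otimes>\<^bsub>F2\<^esub> c) \<odot>\<^bsub>Kh L i j\<^esub> x = b \<odot>\<^bsub>Kh L i j\<^esub> (c \<odot>\<^bsub>Kh L i j\<^esub> x)"
      by (cases b; cases c) (auto simp: z smult_Kh F2_def zero_Kh cocycles_zero)
  qed (auto simp: A.abelian_group_axioms carrier_Kh smult_Kh zero_Kh add_Kh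
      cocycles_zero cocycles_add F2_def)
  then show ?thesis
    by (simp add: vectorspace_def field_F2)
qed

lemma finite_carrier_Kh:
  assumes "finite (generators L)"
  shows "finite (carrier (Kh L i j))"
proof -
  have "(UNIV :: bit set) = {0, 1}"
    using bit_not_zero_iff by blast
  then have "finite (UNIV :: bit set)"
    by (metis finite.emptyI finite.insertI)
  then have "finite {x :: chain. \<forall>g. (g \<in> generators L \<longrightarrow> x g \<in> UNIV) \<and> (g \<notin> generators L \<longrightarrow> x g = 0)}"
    using assms by (intro finite_set_of_finite_funs) simp_all
  moreover have "cocycles L i j \<subseteq> \<dots>"
    unfolding cocycles_def CKh_def by blast
  ultimately show ?thesis
    by (simp add: carrier_Kh finite_subset)
qed

text \<open>The dimension is the least size of a finite spanning set, so it only bounds the space once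
  some finite spanning set is known to exist; the whole space is one when there are finitely many
  generators.\<close>

lemma carrier_Kh_of_dim_le_1:
  assumes "finite (generators L)" "vectorspace.dim F2 (Kh L i j) \<le> 1"
  obtains v where "carrier (Kh L i j) \<subseteq> {\<zero>\<^bsub>Kh L i j\<^esub>, v}"
proof -
  interpret V: vectorspace F2 "Kh L i j" by (rule vectorspace_Kh)
  let ?P = "\<lambda>n. \<exists>A. finite A \<and> card A = n \<and> A \<subseteq> carrier (Kh L i j) \<and> V.gen_set A"
  have "V.gen_set (carrier (Kh L i j))"
    by (meson V.in_own_span V.span_is_subset2 subset_antisym subset_refl)
  then have "?P (card (carrier (Kh L i j)))"
    using finite_carrier_Kh[OF assms(1)] by blast
  then have "?P V.dim"
    unfolding V.dim_def by (rule LeastI)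
  then obtain A where A: "finite A" "card A = V.dim" "A \<subseteq> carrier (Kh L i j)" "V.gen_set A"
    by blast
  obtain v where v: "v \<in> carrier (Kh L i j)" "A \<subseteq> {v}"
  proof (cases "A = {}")
    case True
    then show ?thesis using that[of "\<zero>\<^bsub>Kh L i j\<^esub>"] by simp
  next
    case False
    then have "card A = 1" using A assms(2) card_gt_0_iff[of A] by linarith
    then show ?thesis using that A(3) by (auto simp: card_1_singleton_iff)
  qed
  have "x \<in> {\<zero>\<^bsub>Kh L i j\<^esub>, v}" if "x \<in> carrier (Kh L i j)" for x
  proof -
    from that A(4) obtain c B where B: "B \<subseteq> A" "x = V.lincomb c B"
      unfolding V.span_def by blast
    then consider "B = {}" | "B = {v}" using v(2) by blast
    then show ?thesis
    proof cases
      case 1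
      then show ?thesis by (simp add: B V.lincomb_def)
    next
      case 2
      obtain z where "z \<in> cocycles L i j" "v = cohomology_class L i j z"
        using v(1) by (auto simp: carrier_Kh)
      then have sm: "c v \<odot>\<^bsub>Kh L i j\<^esub> v \<in> {\<zero>\<^bsub>Kh L i j\<^esub>, v}" by (simp add: smult_Kh)
      then have "c v \<odot>\<^bsub>Kh L i j\<^esub> v \<in> carrier (Kh L i j)" using v(1) by auto
      then show ?thesis using 2 sm by (simp add: B V.lincomb_def)
    qed
  qed
  then show ?thesis using that by blast
qed

section \<open>Finiteness of the complex\<close>

lemma finite_image_if_factors:
  assumes "finite (g ` T)" "\<And>s t. s \<in> T \<Longrightarrow> t \<in> T \<Longrightarrow> g s = g t \<Longrightarrow> c s = c t"
  shows "finite (c ` T)"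
proof -
  have "c ` T \<subseteq> (\<lambda>y. c (SOME t. t \<in> T \<and> g t = y)) ` g ` T"
  proof
    fix z assume "z \<in> c ` T"
    then obtain t where t: "t \<in> T" "z = c t" by blast
    define s where "s = (SOME s. s \<in> T \<and> g s = g t)"
    have "s \<in> T \<and> g s = g t" unfolding s_def by (rule someI[of _ t]) (simp add: t)
    then have "z = c s" using assms(2)[of s t] t by simp
    then show "z \<in> (\<lambda>y. c (SOME t. t \<in> T \<and> g t = y)) ` g ` T"
      using t(1) by (auto simp: s_def)
  qed
  then show ?thesis using assms(1) by (blast intro: finite_subset)
qed

text \<open>The component containing a point of a curve is determined by the curve and by the set of the cut
  parameters preceding the point: two parameters with the same set of predecessors bound an interval
  without cuts.  There are finitely many such sets.\<close>

lemma finite_components_of_cut_curves: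
  fixes \<Gamma> :: "(real \<Rightarrow> 'a::topological_space) set"
  assumes "finite \<Gamma>" and cont: "\<And>\<gamma>. \<gamma> \<in> \<Gamma> \<Longrightarrow> continuous_on {0..1} \<gamma>"
    and fin: "\<And>\<gamma>. \<gamma> \<in> \<Gamma> \<Longrightarrow> finite {t \<in> {0..1}. \<gamma> t \<in> P}"
  shows "finite (components ((\<Union>\<gamma>\<in>\<Gamma>. \<gamma> ` {0..1}) - P))"
proof -
  define X where "X = (\<Union>\<gamma>\<in>\<Gamma>. \<gamma> ` {0..1}) - P"
  define F where "F \<gamma> = {t \<in> {0..1}. \<gamma> t \<in> P}" for \<gamma> :: "real \<Rightarrow> 'a"
  have "finite ((\<lambda>t. connected_component_set X (\<gamma> t)) ` ({0..1} - F \<gamma>))" if "\<gamma> \<in> \<Gamma>" for \<gamma>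
  proof (rule finite_image_if_factors[where g = "\<lambda>t. {x \<in> F \<gamma>. x < t}"])
    have "(\<lambda>t. {x \<in> F \<gamma>. x < t}) ` ({0..1} - F \<gamma>) \<subseteq> Pow (F \<gamma>)" by blast
    then show "finite ((\<lambda>t. {x \<in> F \<gamma>. x < t}) ` ({0..1} - F \<gamma>))"
      using fin[OF that] by (simp add: F_def finite_subset)
    have *: "connected_component_set X (\<gamma> s) = connected_component_set X (\<gamma> t)"
      if "s \<in> {0..1} - F \<gamma>" "t \<in> {0..1} - F \<gamma>" "{x \<in> F \<gamma>. x < s} = {x \<in> F \<gamma>. x < t}" "s \<le> t" for s t
    proof -
      have sub: "{s..t} \<subseteq> {0..1} - F \<gamma>"
      proof
        fix r assume r: "r \<in> {s..t}"
        have "r \<notin> F \<gamma>"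
        proof
          assume "r \<in> F \<gamma>"
          moreover have "r \<noteq> t" using that(2) \<open>r \<in> F \<gamma>\<close> by blast
          ultimately have "r \<in> {x \<in> F \<gamma>. x < t}" using r by simp
          then have "r \<in> {x \<in> F \<gamma>. x < s}" by (simp only: that(3))
          then show False using r by simp
        qed
        then show "r \<in> {0..1} - F \<gamma>" using that r by simp
      qed
      then have "\<gamma> ` {s..t} \<subseteq> X"
        using \<open>\<gamma> \<in> \<Gamma>\<close> by (fastforce simp: X_def F_def)
      moreover have "connected (\<gamma> ` {s..t})"
        using sub cont[OF \<open>\<gamma> \<in> \<Gamma>\<close>]
        by (intro connected_continuous_image) (auto intro: continuous_on_subset)
      ultimately have "connected_component X (\<gamma> s) (\<gamma> t)"
        unfolding connected_component_def using \<open>s \<le> t\<close> by (intro exI[of _ "\<gamma> ` {s..t}"]) auto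
      then show ?thesis by (simp add: connected_component_eq_eq connected_component_eq)
    qed
    show "connected_component_set X (\<gamma> s) = connected_component_set X (\<gamma> t)"
      if "s \<in> {0..1} - F \<gamma>" "t \<in> {0..1} - F \<gamma>" "{x \<in> F \<gamma>. x < s} = {x \<in> F \<gamma>. x < t}" for s t
      using *[of s t] *[of t s] that by (metis linear)
  qed
  then have "finite (\<Union>\<gamma>\<in>\<Gamma>. (\<lambda>t. connected_component_set X (\<gamma> t)) ` ({0..1} - F \<gamma>))"
    using assms(1) by blast
  moreover have "components X \<subseteq> \<dots>"
    by (fastforce simp: components_def X_def F_def)
  ultimately show ?thesis
    unfolding X_def by (rule finite_subset[rotated])
qed

lemma period_1_plus_of_int:
  fixes \<gamma> :: "real \<Rightarrow> 'a"
  assumes "\<And>t. \<gamma> (t + 1) = \<gamma> t"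
  shows "\<gamma> (t + of_int n) = \<gamma> t"
proof -
  interpret periodic_fun_simple' \<gamma> by standard (rule assms)
  show ?thesis by (rule plus_of_int)
qed

lemma range_period_1:
  fixes \<gamma> :: "real \<Rightarrow> 'a"
  assumes "\<And>t. \<gamma> (t + 1) = \<gamma> t"
  shows "range \<gamma> = \<gamma> ` {0..1}"
proof -
  have "\<gamma> t \<in> \<gamma> ` {0..1}" for t
  proof (rule image_eqI)
    show "\<gamma> t = \<gamma> (frac t)"
      using period_1_plus_of_int[of \<gamma> "frac t" "\<lfloor>t\<rfloor>", OF assms] by (simp add: frac_def)
    show "frac t \<in> {0..1}"
      by (simp add: frac_lt_1 less_imp_le)
  qed
  then show ?thesis by blast
qed

lemma link_set_memI: "\<gamma> \<in> set L \<Longrightarrow> \<gamma> t \<in> link_set L"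
  unfolding link_set_def by blast

text \<open>The points of the three-sphere whose first component vanishes are \<open>\<plusminus>\<infinity>\<close>, which a generic link misses.\<close>

lemma fst_nonzero:
  assumes "is_link L" "generic L" "x \<in> link_set L"
  shows "fst x \<noteq> 0"
proof
  assume "fst x = 0"
  moreover have "norm x = 1"
    using assms(1,3) by (fastforce simp: is_link_def link_set_def S3_def)
  ultimately have "\<bar>snd x\<bar> = 1" by (simp add: norm_prod_def)
  then have "x = (0, 1) \<or> x = (0, -1)"
    using \<open>fst x = 0\<close> by (cases x) (auto simp: abs_if split: if_splits)
  then show False using assms(2,3) by (auto simp: generic_def)
qed

text \<open>A component of the link passes through each of the finitely many points over crossings only once
  per period, so each projected component is cut at finitely many parameters.\<close>

lemma finite_arcs:
  assumes L: "is_link L" "generic L"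
  shows "finite (arcs L)"
proof -
  have period: "\<gamma> (t + 1) = \<gamma> t" and smooth: "smooth \<gamma>" if "\<gamma> \<in> set L" for \<gamma> t
    using L(1) that by (auto simp: is_link_def)
  have inj: "inj_on \<gamma> {0..<1}" if \<gamma>: "\<gamma> \<in> set L" for \<gamma>
  proof (rule inj_onI)
    fix s t :: real assume st: "s \<in> {0..<1}" "t \<in> {0..<1}" "\<gamma> s = \<gamma> t"
    obtain k where "k < length L" "\<gamma> = L ! k" using \<gamma> by (auto simp: in_set_conv_nth)
    then have "s - t \<in> \<int>" using L(1) st(3) unfolding is_link_def by blast
    moreover have "\<bar>s - t\<bar> < 1" using st by auto
    ultimately show "s = t" using Ints_nonzero_abs_less1 by fastforce
  qed
  have "continuous_on {0..1} (shadow \<circ> \<gamma>)" if \<gamma>: "\<gamma> \<in> set L" for \<gamma>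
  proof -
    obtain D where D: "D 0 = \<gamma>" "\<And>k t. (D k has_vector_derivative D (Suc k) t) (at t)"
      using smooth[OF \<gamma>] unfolding smooth_def by blast
    then have "isCont \<gamma> t" for t
      using has_vector_derivative_continuous[OF D(2)[of 0 t]] by simp
    then have "continuous_on {0..1} \<gamma>"
      by (simp add: continuous_at_imp_continuous_on)
    moreover have "fst (\<gamma> t) \<noteq> 0" for t
      by (rule fst_nonzero[OF L link_set_memI[OF \<gamma>]])
    ultimately show ?thesis
      unfolding shadow_def comp_def sgn_div_norm by (intro continuous_intros) auto
  qed
  moreover have "finite {t \<in> {0..1}. (shadow \<circ> \<gamma>) t \<in> crossings L}" if "\<gamma> \<in> set L" for \<gamma>
  proof -
    have "\<gamma> ` {t \<in> {0..<1}. shadow (\<gamma> t) \<in> crossings L} \<subseteq> (\<Union>p\<in>crossings L. fibre L p)"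
      using link_set_memI[OF that] by (auto simp: fibre_def)
    moreover have "finite (\<Union>p\<in>crossings L. fibre L p)"
      using L(2) by (auto simp: generic_def)
    ultimately have "finite (\<gamma> ` {t \<in> {0..<1}. shadow (\<gamma> t) \<in> crossings L})"
      by (rule finite_subset)
    then have "finite {t \<in> {0..<1}. shadow (\<gamma> t) \<in> crossings L}"
      by (rule finite_imageD) (rule inj_on_subset[OF inj[OF that]], blast)
    \<comment> \<open>The end of the period is added separately, since the curve is injective only on \<open>{0..<1}\<close>.\<close>
    then have "finite (insert 1 {t \<in> {0..<1}. shadow (\<gamma> t) \<in> crossings L})"
      by simp
    then show ?thesis
      by (rule finite_subset[rotated]) auto
  qed
  ultimately have "finite (components ((\<Union>\<gamma>\<in>(\<lambda>\<gamma>. shadow \<circ> \<gamma>) ` set L. \<gamma> ` {0..1}) - crossings L))"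
    by (intro finite_components_of_cut_curves) auto
  moreover have "(\<Union>\<gamma>\<in>(\<lambda>\<gamma>. shadow \<circ> \<gamma>) ` set L. \<gamma> ` {0..1}) = shadow ` link_set L"
  proof -
    have "range \<gamma> = \<gamma> ` {0..1}" if "\<gamma> \<in> set L" for \<gamma>
      by (rule range_period_1) (rule period[OF that])
    then show ?thesis
      by (auto simp: link_set_def simp flip: image_comp)
  qed
  ultimately show ?thesis by (simp add: arcs_def)
qed

lemma finite_generators:
  assumes "is_link L" "generic L"
  shows "finite (generators L)"
proof -
  have "circles L s \<subseteq> Pow (arcs L)" for s
    by (auto simp: circles_def quotient_def)
  then have "generators L \<subseteq> Pow (crossings L) \<times> Pow (Pow (arcs L))"
    by (auto simp: generators_def)
  moreover have "finite (crossings L)" using assms(2) by (simp add: generic_def)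
  ultimately show ?thesis
    using finite_arcs[OF assms] by (meson finite_Pow_iff finite_SigmaI finite_subset)
qed

section \<open>The reflection of the sphere and the involution of the three-sphere\<close>

lemma linear_reflection: "linear (reflection a)"
  by (rule linearI) (simp_all add: reflection_def inner_add_left algebra_simps)

lemma reflection_involution:
  assumes "norm a = 1"
  shows "reflection a (reflection a p) = p"
proof -
  have "a \<bullet> a = 1" using assms by (simp add: dot_square_norm)
  then show ?thesis by (simp add: reflection_def inner_diff_left scaleR_diff_left)
qed

lemma norm_reflection:
  assumes "norm a = 1"
  shows "norm (reflection a p) = norm p"
proof -
  have "a \<bullet> a = 1" using assms by (simp add: dot_square_norm)
  then have "reflection a p \<bullet> reflection a p = p \<bullet> p"
    by (simp add: reflection_def inner_diff_left inner_diff_right inner_commute)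
  then show ?thesis by (simp add: norm_eq)
qed

lemma sgn_reflection: "norm a = 1 \<Longrightarrow> sgn (reflection a p) = reflection a (sgn p)"
  by (simp add: sgn_div_norm norm_reflection linear_cmul[OF linear_reflection])

text \<open>The reflection has determinant \<open>-1\<close>.  Writing \<open>[p, u, v]\<close> for the triple product and expanding
  multilinearly, the terms with two or three factors \<open>a\<close> vanish, and those with one such factor add up to
  \<open>-2 [p, u, v]\<close> by Cramer's rule for the coordinates of \<open>a\<close>.\<close>

lemma triple_product_reflection:
  assumes "norm a = 1"
  shows "reflection a p \<bullet> cross3 (reflection a u) (reflection a v) = - (p \<bullet> cross3 u v)"
proof -
  have cramer: "(a \<bullet> a) * (p \<bullet> cross3 u v) =
      (p \<bullet> a) * (a \<bullet> cross3 u v) + (u \<bullet> a) * (p \<bullet> cross3 a v) + (v \<bullet> a) * (p \<bullet> cross3 u a)"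
    by (simp add: cross3_def inner_vec_def sum_3 algebra_simps)
  have "reflection a p \<bullet> cross3 (reflection a u) (reflection a v) = p \<bullet> cross3 u v - 2 *
      ((p \<bullet> a) * (a \<bullet> cross3 u v) + (u \<bullet> a) * (p \<bullet> cross3 a v) + (v \<bullet> a) * (p \<bullet> cross3 u a))"
    by (simp add: reflection_def cross3_def inner_vec_def sum_3 algebra_simps)
  also have "\<dots> = - (p \<bullet> cross3 u v)"
    using cramer assms by (simp add: dot_square_norm)
  finally show ?thesis .
qed

lemma tau_involution: "norm a = 1 \<Longrightarrow> tau a (tau a x) = x"
  by (simp add: tau_def reflection_involution)

lemma inj_reflection: "norm a = 1 \<Longrightarrow> inj (reflection a)"
  by (metis injI reflection_involution)

lemma shadow_tau: "norm a = 1 \<Longrightarrow> shadow (tau a x) = reflection a (shadow x)"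
  by (simp add: shadow_def tau_def sgn_reflection)

lemma height_tau: "norm a = 1 \<Longrightarrow> height (tau a x) = - height x"
  by (simp add: height_def tau_def norm_reflection)

lemma continuous_reflection: "continuous_on S (reflection a)"
  unfolding reflection_def by (intro continuous_intros)

lemma tendsto_reflection:
  "(f \<longlongrightarrow> p) F \<Longrightarrow> ((\<lambda>x. reflection a (f x)) \<longlongrightarrow> reflection a p) F"
  unfolding reflection_def by (intro tendsto_intros)

lemma tendsto_tau: "(f \<longlongrightarrow> x) F \<Longrightarrow> ((\<lambda>n. tau a (f n)) \<longlongrightarrow> tau a x) F"
  unfolding tau_def by (intro tendsto_intros tendsto_reflection)

lemma cylinder_shadow_height:
  assumes "x \<in> S3" "fst x \<noteq> 0"
  shows "cylinder (shadow x) (height x) = x"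
proof -
  obtain y q where x: "x = (y, q)" by (cases x)
  define r where "r = norm y"
  have r: "r > 0" using assms(2) by (simp add: x r_def)
  have "r\<^sup>2 + q\<^sup>2 = 1"
    using assms(1) by (simp add: S3_def x r_def norm_prod_def real_sqrt_eq_1_iff)
  then have "1 + (q / r)\<^sup>2 = (1 / r)\<^sup>2"
    using r by (simp add: field_simps power2_eq_square)
  then have "sqrt (1 + (q / r)\<^sup>2) = 1 / r"
    using r by (simp add: real_sqrt_unique)
  then show ?thesis
    using r by (simp add: cylinder_def shadow_def height_def x sgn_div_norm flip: r_def)
qed

section \<open>The symmetry of an involutive diagram\<close>

text \<open>What the argument uses of a generic representative: an equivariant isotopy makes its underlying
  set symmetric, and the orientations of the components enter the complex only through the constant
  shifts of the gradings.\<close>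

locale involutive_diagram =
  fixes a :: "real^3" and L :: link
  assumes norm_a: "norm a = 1"
    and link: "is_link L"
    and generic: "generic L"
    and symmetric: "tau a ` link_set L = link_set L"
begin

abbreviation R where "R \<equiv> reflection a"

lemmas R_R [simp] = reflection_involution[OF norm_a]
  and tau_tau [simp] = tau_involution[OF norm_a]

lemma inj_R: "inj R"
  by (rule inj_reflection[OF norm_a])

lemma R_image_R [simp]: "R ` R ` e = e"
  by (simp add: image_image)

lemma tau_mem: "x \<in> link_set L \<Longrightarrow> tau a x \<in> link_set L"
  using symmetric by blast

lemma fibre_R: "fibre L (R p) = tau a ` fibre L p"
proof -
  have *: "tau a ` fibre L p \<subseteq> fibre L (R p)" for p
    by (auto simp: fibre_def tau_mem shadow_tau[OF norm_a])
  have "fibre L (R p) = tau a ` tau a ` fibre L (R p)"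
    by (simp add: image_image)
  also have "\<dots> \<subseteq> tau a ` fibre L p"
    using *[of "R p"] by (intro image_mono) simp
  finally show ?thesis using * by blast
qed

lemma R_mem_crossings: "R p \<in> crossings L \<longleftrightarrow> p \<in> crossings L"
proof -
  have "inj (tau a)" by (metis injI tau_tau)
  then have "card (fibre L (R p)) = card (fibre L p)"
    by (simp add: fibre_R card_image[OF inj_on_subset[OF _ subset_UNIV]])
  then show ?thesis by (simp add: crossings_def)
qed

lemma R_crossings: "R ` crossings L = crossings L"
  by (metis (no_types, lifting) R_R R_mem_crossings image_iff subsetI subset_antisym)

text \<open>Shadow and height are coordinates on the complement of \<open>\<plusminus>\<infinity>\<close>, and a fibre fixes the shadow.\<close>

lemma inj_on_height_fibre: "inj_on height (fibre L p)"
proof (rule inj_onI)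
  fix x y assume xy: "x \<in> fibre L p" "y \<in> fibre L p" "height x = height y"
  then have "x \<in> link_set L" "y \<in> link_set L" "shadow x = shadow y"
    by (auto simp: fibre_def)
  moreover have "link_set L \<subseteq> S3"
    using link by (auto simp: is_link_def link_set_def)
  ultimately show "x = y"
    using cylinder_shadow_height fst_nonzero[OF link generic] xy(3) by (metis subsetD)
qed

text \<open>The two strands at a crossing have different heights, so \<open>over\<close> and \<open>under\<close> are genuine
  extrema; negating the height exchanges them.\<close>

lemma extremal_height_iff:
  assumes "p \<in> crossings L"
  shows "is_arg_max height (\<lambda>x. x \<in> fibre L p) x \<longleftrightarrow> x = over L p"
    and "is_arg_min height (\<lambda>x. x \<in> fibre L p) x \<longleftrightarrow> x = under L p"
proof -
  have card: "card (fibre L p) = 2" using assms by (simp add: crossings_def)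
  then have fin: "finite (fibre L p)" "fibre L p \<noteq> {}"
    by (auto intro: card_ge_0_finite)
  have "\<exists>x. is_arg_min (\<lambda>x. - height x) (\<lambda>x. x \<in> fibre L p) x"
    using ex_is_arg_min_if_finite[OF fin, of "\<lambda>x. - height x"] by blast
  then have "\<exists>x. is_arg_max height (\<lambda>x. x \<in> fibre L p) x"
    by (simp add: is_arg_max_def is_arg_min_def)
  then have "is_arg_max height (\<lambda>x. x \<in> fibre L p) (over L p)"
    unfolding over_def arg_max_def by (rule someI_ex)
  then show "is_arg_max height (\<lambda>x. x \<in> fibre L p) x \<longleftrightarrow> x = over L p"
    using inj_onD[OF inj_on_height_fibre[of p]] by (metis is_arg_max_def linorder_neqE_linordered_idom)
  have "\<exists>x. is_arg_min height (\<lambda>x. x \<in> fibre L p) x"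
    using ex_is_arg_min_if_finite[OF fin, of height] by blast
  then have "is_arg_min height (\<lambda>x. x \<in> fibre L p) (under L p)"
    unfolding under_def arg_min_def by (rule someI_ex)
  then show "is_arg_min height (\<lambda>x. x \<in> fibre L p) x \<longleftrightarrow> x = under L p"
    using inj_onD[OF inj_on_height_fibre[of p]] by (metis is_arg_min_def linorder_neqE_linordered_idom)
qed

lemma over_R:
  assumes p: "p \<in> crossings L"
  shows "over L (R p) = tau a (under L p)"
proof -
  have "is_arg_min height (\<lambda>x. x \<in> fibre L p) (under L p)"
    using p by (simp add: extremal_height_iff)
  then have "is_arg_max height (\<lambda>x. x \<in> fibre L (R p)) (tau a (under L p))"
    by (auto simp: is_arg_max_def is_arg_min_def fibre_R height_tau[OF norm_a])
  then show ?thesis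
    using p by (simp add: extremal_height_iff R_mem_crossings)
qed

lemma under_R:
  assumes p: "p \<in> crossings L"
  shows "under L (R p) = tau a (over L p)"
  using over_R[of "R p"] p by (simp add: R_mem_crossings)

text \<open>The reflection restricts to a self-homeomorphism of the projection without the crossings.\<close>

lemma R_image_arcs:
  assumes "e \<in> arcs L"
  shows "R ` e \<in> arcs L"
proof -
  let ?X = "shadow ` link_set L - crossings L"
  have "R ` shadow ` link_set L = shadow ` tau a ` link_set L"
    by (simp add: image_image shadow_tau[OF norm_a])
  then have X: "R ` ?X = ?X"
    by (simp only: image_set_diff[OF inj_R] R_crossings symmetric)
  have "homeomorphism ?X ?X R R"
    by (rule homeomorphismI) (use X in \<open>auto intro: continuous_reflection\<close>)
  then have "connected_component_set ?X (R p) = R ` connected_component_set ?X p" if "p \<in> ?X" for p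
    using that by (rule connected_component_set_homeomorphism)
  then show ?thesis
    using assms X unfolding arcs_def components_def by (smt (verit) image_iff)
qed

lemma R_arc_directions:
  assumes "w \<in> arc_directions e p"
  shows "R w \<in> arc_directions (R ` e) (R p)"
proof -
  obtain y where y: "\<And>n. y n \<in> e" "y \<longlonglongrightarrow> p" "(\<lambda>n. sgn (y n - p)) \<longlonglongrightarrow> w"
    using assms by (auto simp: arc_directions_def)
  have "sgn (R (y n) - R p) = R (sgn (y n - p))" for n :: nat
    by (simp add: sgn_reflection[OF norm_a] flip: linear_diff[OF linear_reflection])
  then show ?thesis
    unfolding arc_directions_def using y tendsto_reflection[of _ _ sequentially a]
    by (intro CollectI exI[of _ "\<lambda>n. R (y n)"]) simp
qed

lemma R_strand_directions:
  assumes "w \<in> strand_directions L x"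
  shows "R w \<in> strand_directions L (tau a x)"
proof -
  obtain y where y: "\<And>n. y n \<in> link_set L - {x}" "y \<longlonglongrightarrow> x"
      "(\<lambda>n. sgn (shadow (y n) - shadow x)) \<longlonglongrightarrow> w"
    using assms by (auto simp: strand_directions_def)
  have "sgn (shadow (tau a (y n)) - shadow (tau a x)) = R (sgn (shadow (y n) - shadow x))" for n :: nat
    by (simp add: sgn_reflection[OF norm_a] shadow_tau[OF norm_a] flip: linear_diff[OF linear_reflection])
  moreover have "tau a (y n) \<in> link_set L - {tau a x}" for n
    using y(1)[of n] tau_mem by (metis Diff_iff singletonD singletonI tau_tau)
  ultimately show ?thesis
    unfolding strand_directions_def using y tendsto_reflection[of _ _ sequentially a] tendsto_tau[of y]
    by (intro CollectI exI[of _ "\<lambda>n. tau a (y n)"]) simp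
qed

text \<open>Both the exchange of over- and under-strand and the reversal of orientation of the sphere change
  the smoothing, so together they preserve it; only the two ends of a join trade places.\<close>

lemma joined_R:
  assumes "(e, f) \<in> joined L s"
  shows "(R ` f, R ` e) \<in> joined L (R ` s)"
proof -
  obtain p u v where ef: "e \<in> arcs L" "f \<in> arcs L" and p: "p \<in> crossings L"
    and u: "u \<in> arc_directions e p" "u \<in> strand_directions L (over L p)"
    and v: "v \<in> arc_directions f p" "v \<in> strand_directions L (under L p)"
    and sign: "if p \<in> s then p \<bullet> cross3 u v > 0 else p \<bullet> cross3 u v < 0"
    using assms unfolding joined_def by blast
  have "R v \<in> arc_directions (R ` f) (R p) \<inter> strand_directions L (over L (R p))"
    using v by (simp add: over_R[OF p] R_arc_directions R_strand_directions)
  moreover have "R u \<in> arc_directions (R ` e) (R p) \<inter> strand_directions L (under L (R p))"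
    using u by (simp add: under_R[OF p] R_arc_directions R_strand_directions)
  moreover have "R p \<bullet> cross3 (R v) (R u) = p \<bullet> cross3 u v"
    by (simp add: triple_product_reflection[OF norm_a] cross_skew[of v u])
  then have "if R p \<in> R ` s then R p \<bullet> cross3 (R v) (R u) > 0 else R p \<bullet> cross3 (R v) (R u) < 0"
    using sign by (simp add: inj_image_mem_iff[OF inj_R])
  moreover have "R p \<in> crossings L" by (simp add: R_mem_crossings p)
  moreover have "R ` e \<in> arcs L" "R ` f \<in> arcs L" using ef by (simp_all add: R_image_arcs)
  ultimately show ?thesis unfolding joined_def by blast
qed

lemma inj_reflect_circle: "inj (reflect_circle a)"
  unfolding reflect_circle_def using inj_R by (simp add: inj_image_eq_iff inj_def)

lemma reflect_circle_involution [simp]: "reflect_circle a (reflect_circle a C) = C"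
  by (simp add: reflect_circle_def image_image)

text \<open>The reflection preserves the relation of being joined up to transposition (\<open>joined_R\<close>), hence its
  symmetric closure and the equivalence relation generated by it, whose classes are the circles.\<close>

lemma reflect_circle_mem_circles:
  assumes "C \<in> circles L s"
  shows "reflect_circle a C \<in> circles L (R ` s)"
proof -
  \<comment> \<open>\<open>K\<close> is the symmetrised relation of being joined, \<open>Q\<close> the equivalence relation it generates.\<close>
  define K where "K s = joined L s \<union> (joined L s)\<inverse>" for s
  define Q where "Q s = (K s)\<^sup>* \<inter> arcs L \<times> arcs L" for s
  have K: "(R ` e, R ` f) \<in> (K (R ` s))\<^sup>*" if "(e, f) \<in> (K s)\<^sup>*" for e f s
    using that
  proof induction
    case (step f g)
    then have "(R ` f, R ` g) \<in> K (R ` s)"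
      unfolding K_def using joined_R by blast
    with step.IH show ?case by (rule rtrancl_into_rtrancl)
  qed simp
  have Q: "(R ` e, R ` f) \<in> Q (R ` s)" if "(e, f) \<in> Q s" for e f s
    using that K R_image_arcs by (auto simp: Q_def)
  obtain e where e: "e \<in> arcs L" "C = Q s `` {e}"
    using assms by (auto simp: circles_def Q_def K_def quotient_def)
  have "reflect_circle a C = Q (R ` s) `` {R ` e}"
  proof (intro subset_antisym subsetI)
    fix f assume "f \<in> reflect_circle a C"
    then show "f \<in> Q (R ` s) `` {R ` e}" using Q e(2) by (auto simp: reflect_circle_def)
  next
    fix f assume "f \<in> Q (R ` s) `` {R ` e}"
    then have "(R ` R ` e, R ` f) \<in> Q (R ` R ` s)" using Q by blast
    then have "R ` f \<in> C" using e(2) by simp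
    then have "R ` R ` f \<in> reflect_circle a C" unfolding reflect_circle_def by (rule imageI)
    then show "f \<in> reflect_circle a C" by simp
  qed
  moreover have "R ` e \<in> arcs L" using e(1) by (rule R_image_arcs)
  ultimately show ?thesis
    unfolding circles_def Q_def K_def by (simp only: quotientI)
qed

lemma circles_R: "circles L (R ` s) = reflect_circle a ` circles L s"
proof (intro subset_antisym subsetI)
  fix C assume "C \<in> circles L (R ` s)"
  then have "reflect_circle a C \<in> circles L s"
    using reflect_circle_mem_circles[of C "R ` s"] by simp
  then show "C \<in> reflect_circle a ` circles L s"
    by (metis imageI reflect_circle_involution)
qed (auto intro: reflect_circle_mem_circles)

abbreviation \<rho> where "\<rho> \<equiv> reflect_generator a"

lemma \<rho>_\<rho> [simp]: "\<rho> (\<rho> g) = g"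
  by (simp add: reflect_generator_def split_beta image_image)

lemma \<rho>_mem_generators: "\<rho> g \<in> generators L \<longleftrightarrow> g \<in> generators L"
proof -
  have *: "\<rho> g \<in> generators L" if "g \<in> generators L" for g
  proof (cases g)
    case (Pair s P)
    then have "R ` s \<subseteq> R ` crossings L" "reflect_circle a ` P \<subseteq> reflect_circle a ` circles L s"
      using that by (auto simp: generators_def)
    then show ?thesis
      using Pair by (simp add: generators_def reflect_generator_def circles_R R_crossings)
  qed
  then show ?thesis by (metis \<rho>_\<rho>)
qed

lemma hom_degree_\<rho>: "hom_degree L (\<rho> g) = hom_degree L g"
  by (cases g) (simp add: hom_degree_def reflect_generator_def card_image inj_on_subset[OF inj_R])

lemma quantum_degree_\<rho>: "quantum_degree L (\<rho> g) = quantum_degree L g"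
proof -
  have "card (reflect_circle a ` A) = card A" for A
    using inj_on_subset[OF inj_reflect_circle] by (simp add: card_image)
  then show ?thesis
    by (cases g) (simp add: quantum_degree_def reflect_generator_def circles_R card_image
        inj_on_subset[OF inj_R] flip: image_set_diff[OF inj_reflect_circle])
qed

text \<open>Incidence is expressed through the crossings, the circles and membership in the decorations, all
  of which are carried along by the injective maps \<open>R\<close> and \<open>reflect_circle a\<close>.\<close>

lemma incident_\<rho>: "incident L (\<rho> g) (\<rho> h) \<longleftrightarrow> incident L g h"
proof -
  let ?c = "reflect_circle a"
  note mem = inj_image_mem_iff[OF inj_reflect_circle]
  have m: "merges (?c ` A) (?c ` P) (?c ` B) (?c ` Q)" if "merges A P B Q" for A P B Q
  proof -
    obtain x y b where "x \<noteq> y" "A = {x, y}" "B = {b}"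
      "if b \<in> Q then x \<in> P \<and> y \<in> P else (x \<in> P) \<noteq> (y \<in> P)"
      using \<open>merges A P B Q\<close> unfolding merges_def by blast
    then show ?thesis
      unfolding merges_def using inj_eq[OF inj_reflect_circle]
      by (intro exI[of _ "?c x"] exI[of _ "?c y"] exI[of _ "?c b"]) (simp add: mem)
  qed
  have sp: "splits (?c ` A) (?c ` P) (?c ` B) (?c ` Q)" if "splits A P B Q" for A P B Q
  proof -
    obtain x b b' where "b \<noteq> b'" "A = {x}" "B = {b, b'}"
      "if x \<in> P then (b \<in> Q) \<noteq> (b' \<in> Q) else b \<notin> Q \<and> b' \<notin> Q"
      using \<open>splits A P B Q\<close> unfolding splits_def by blast
    then show ?thesis
      unfolding splits_def using inj_eq[OF inj_reflect_circle]
      by (intro exI[of _ "?c x"] exI[of _ "?c b"] exI[of _ "?c b'"]) (simp add: mem)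
  qed
  have *: "incident L (\<rho> g) (\<rho> h)" if inc: "incident L g h" for g h
  proof -
    obtain s P s' P' where gh: "g = (s, P)" "h = (s', P')" by (metis surj_pair)
    obtain p where p: "p \<in> crossings L" "p \<notin> s" "s' = insert p s"
      using inc unfolding incident_def gh prod.case by blast
    have "R p \<in> crossings L - R ` s" "R ` s' = insert (R p) (R ` s)"
      using p by (simp_all add: R_mem_crossings inj_image_mem_iff[OF inj_R])
    then have "\<exists>q \<in> crossings L - R ` s. R ` s' = insert q (R ` s)" by blast
    moreover have "?c ` P \<inter> circles L (R ` s') = ?c ` P' \<inter> circles L (R ` s)"
      using inc by (simp add: incident_def gh circles_R flip: image_Int[OF inj_reflect_circle])
    moreover have "merges (circles L (R ` s) - circles L (R ` s')) (?c ` P) (circles L (R ` s') - circles L (R ` s)) (?c ` P') \<or>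
      splits (circles L (R ` s) - circles L (R ` s')) (?c ` P) (circles L (R ` s') - circles L (R ` s)) (?c ` P')"
      using inc m sp by (simp add: incident_def gh circles_R flip: image_set_diff[OF inj_reflect_circle]) blast
    ultimately show ?thesis
      by (simp add: incident_def gh reflect_generator_def)
  qed
  then show ?thesis by (metis \<rho>_\<rho>)
qed

lemma tau_chain_diff: "tau_chain a (diff L x) = diff L (tau_chain a x)"
proof
  fix h
  have "(\<Sum>g\<in>{g \<in> generators L. incident L g (\<rho> h)}. x g) =
      (\<Sum>g\<in>{g \<in> generators L. incident L g h}. x (\<rho> g))"
  proof (rule sum.reindex_bij_witness[where i = \<rho> and j = \<rho>])
    fix g
    show "\<rho> g \<in> {g \<in> generators L. incident L g h}"
      if "g \<in> {g \<in> generators L. incident L g (\<rho> h)}"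
      using that incident_\<rho>[of g "\<rho> h"] by (simp add: \<rho>_mem_generators)
    show "\<rho> g \<in> {g \<in> generators L. incident L g (\<rho> h)}"
      if "g \<in> {g \<in> generators L. incident L g h}"
      using that by (simp add: \<rho>_mem_generators incident_\<rho>)
  qed simp_all
  then show "tau_chain a (diff L x) h = diff L (tau_chain a x) h"
    by (simp add: tau_chain_def diff_def \<rho>_mem_generators)
qed

lemma tau_chain_tau_chain [simp]: "tau_chain a (tau_chain a x) = x"
  by (simp add: tau_chain_def)

lemma tau_chain_CKh:
  assumes "x \<in> CKh L i j"
  shows "tau_chain a x \<in> CKh L i j"
proof -
  have "\<rho> g \<in> generators L \<and> hom_degree L (\<rho> g) = i \<and> quantum_degree L (\<rho> g) = j"
    if "tau_chain a x g \<noteq> 0" for g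
    using assms that unfolding CKh_def tau_chain_def by blast
  then show ?thesis
    unfolding CKh_def \<rho>_mem_generators hom_degree_\<rho> quantum_degree_\<rho> by blast
qed

lemma tau_chain_cocycles:
  assumes "x \<in> cocycles L i j"
  shows "tau_chain a x \<in> cocycles L i j"
proof -
  have "diff L (tau_chain a x) = tau_chain a 0"
    using assms by (simp add: cocycles_def flip: tau_chain_diff)
  then show ?thesis
    using assms by (simp add: cocycles_def tau_chain_CKh) (simp add: tau_chain_def zero_fun_def)
qed

lemma tau_chain_coboundaries: "x \<in> coboundaries L i j \<Longrightarrow> tau_chain a x \<in> coboundaries L i j"
  unfolding coboundaries_def using tau_chain_diff tau_chain_CKh by blast

end


section \<open>The induced differential vanishes\<close>

context involutive_diagram
begin

text \<open>A nontrivial class and its image under the involution are both nonzero, hence equal, as there is at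
  most one nonzero class; in characteristic two their sum then vanishes.\<close>

lemma d_tau_mem_coboundaries:
  assumes dim: "vectorspace.dim F2 (Kh L i j) \<le> 1" and z: "z \<in> cocycles L i j"
  shows "d_tau a z \<in> coboundaries L i j"
proof (cases "z \<in> coboundaries L i j")
  case True
  then show ?thesis
    by (simp add: d_tau_def coboundaries_add tau_chain_coboundaries)
next
  case False
  have not_zero: "cohomology_class L i j x \<noteq> \<zero>\<^bsub>Kh L i j\<^esub>"
    if "x \<in> cocycles L i j" "x \<notin> coboundaries L i j" for x
    using that cohomology_class_eq_iff[OF that(1) cocycles_zero] by (simp add: zero_Kh)
  have "tau_chain a z \<notin> coboundaries L i j"
    using False tau_chain_coboundaries[of "tau_chain a z"] by auto
  then have "cohomology_class L i j (tau_chain a z) \<noteq> \<zero>\<^bsub>Kh L i j\<^esub>"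
    by (intro not_zero tau_chain_cocycles z)
  moreover have "cohomology_class L i j z \<noteq> \<zero>\<^bsub>Kh L i j\<^esub>"
    by (intro not_zero z False)
  moreover obtain v where "carrier (Kh L i j) \<subseteq> {\<zero>\<^bsub>Kh L i j\<^esub>, v}"
    using carrier_Kh_of_dim_le_1[OF finite_generators[OF link generic] dim] .
  ultimately have "cohomology_class L i j z = cohomology_class L i j (tau_chain a z)"
    using z tau_chain_cocycles[OF z] by (auto simp: carrier_Kh)
  then show ?thesis
    using z by (simp add: d_tau_def cohomology_class_eq_iff tau_chain_cocycles)
qed

lemma d_tau_star_eq_zero:
  assumes dim: "vectorspace.dim F2 (Kh L i j) \<le> 1" and C: "C \<in> carrier (Kh L i j)"
  shows "d_tau_star a L i j C = \<zero>\<^bsub>Kh L i j\<^esub>"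
proof -
  obtain z where z: "z \<in> cocycles L i j" "C = cohomology_class L i j z"
    using C by (auto simp: carrier_Kh)
  have zero: "cohomology_class L i j (d_tau a x) = \<zero>\<^bsub>Kh L i j\<^esub>" if "x \<in> C" for x
  proof -
    have x: "x \<in> cocycles L i j"
      using that z by (simp add: cohomology_class_def)
    then have "d_tau a x \<in> cocycles L i j"
      by (simp add: d_tau_def cocycles_add tau_chain_cocycles)
    then show ?thesis
      using d_tau_mem_coboundaries[OF dim x] by (simp add: zero_Kh cohomology_class_eq_iff cocycles_zero)
  qed
  have "z \<in> C" using z by (simp add: cohomology_class_self)
  then have "the_elem ((\<lambda>x. cohomology_class L i j (d_tau a x)) ` C) = cohomology_class L i j (d_tau a z)"
    by (rule the_elem_image_const) (simp add: zero \<open>z \<in> C\<close>)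
  then show ?thesis
    by (simp add: d_tau_star_def zero \<open>z \<in> C\<close>)
qed

end

lemma involutive_diagram_of_generic_representative:
  assumes "norm a = 1" "involutive_link a L" "generic_representative a L D"
  shows "involutive_diagram a D"
proof
  show "norm a = 1" "is_link D" "generic D"
    using assms by (simp_all add: generic_representative_def)
  obtain H :: "real \<Rightarrow> space \<Rightarrow> space" where
      equivariant: "\<forall>t\<in>{0..1}. \<forall>x\<in>S3. H t (tau a x) = tau a (H t x)"
      and D: "H 1 ` link_set L = link_set D"
    using assms(3) unfolding generic_representative_def equivariantly_isotopic_def
    by (elim conjE exE) (rule that; assumption)
  have tau_L: "tau a ` link_set L = link_set L" and sub: "link_set L \<subseteq> S3"
    using assms(2) by (auto simp: involutive_link_def is_link_def link_set_def)
  have "tau a (H 1 x) = H 1 (tau a x)" if "x \<in> link_set L" for x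
    using equivariant subsetD[OF sub that] by simp
  then have "tau a ` H 1 ` link_set L = H 1 ` tau a ` link_set L"
    unfolding image_image by (rule image_cong[OF refl])
  then show "tau a ` link_set D = link_set D"
    by (simp only: D tau_L)
qed

theorem proposition1p3:
  fixes a :: "real^3" and L D :: link and i j :: int
  assumes "norm a = 1"
    and "involutive_link a L"
    and "generic_representative a L D"
    and "vectorspace.dim F2 (Kh D i j) \<le> 1"
  shows "\<forall>C \<in> carrier (Kh D i j). d_tau_star a D i j C = \<zero>\<^bsub>Kh D i j\<^esub>"
proof -
  interpret involutive_diagram a D
    using assms(1-3) by (rule involutive_diagram_of_generic_representative)
  show ?thesis
    using d_tau_star_eq_zero[OF assms(4)] by blast
qed

end
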